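(* Let $-\infty<m<M<\infty$ with $[m,M]\subseteq\mathbb{R}_+=[0,\infty)$ and $m\le 1\le M$. Let $f$ be a $3$-convex function on an interval $I\subseteq\mathbb{R}$ whose interior contains $[m,M]$, and suppose $f$ is differentiable on $(m,M)$. Let $\boldsymbol{p}=(p_1,\dots,p_n)$ and $\boldsymbol{q}=(q_1,\dots,q_n)$ be probability distributions with $q_i>0$ and $p_i/q_i\in[m,M]$ for every $i=1,\dots,n$. Then $$(M-1)\left[f_-'(M)-\frac{f(M)-f(m)}{M-m}\right]-\frac{f_-''(M)}{2}\sum_{i=1}^n\frac{(Mq_i-p_i)^2}{q_i}$$ $$\le \frac{M-1}{M-m}f(m)+\frac{1-m}{M-m}f(M)-\tilde{D}_f(\boldsymbol{p},\boldsymbol{q})$$ $$\le (1-m)\left[\frac{f(M)-f(m)}{M-m}-f_+'(m)\right]-\frac{f_+''(m)}{2}\sum_{i=1}^n\frac{(p_i-mq_i)^2}{q_i}.$$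
   Context: A probability distribution $\boldsymbol{p}=(p_1,\dots,p_n)$ has $p_i\in[0,1]$ and $\sum_{i=1}^n p_i=1$. The generalized $f$-divergence functional is $\tilde{D}_f(\boldsymbol{p},\boldsymbol{q})=\sum_{i=1}^n q_i f\!\left(\frac{p_i}{q_i}\right)$. Divided differences: for mutually distinct points $t_0,\dots,t_n$, $[t_i]f=f(t_i)$ and $[t_0,\dots,t_n]f=\dfrac{[t_1,\dots,t_n]f-[t_0,\dots,t_{n-1}]f}{t_n-t_0}$. A function $f$ on an interval $I$ is $3$-convex if $[t_0,t_1,t_2,t_3]f\ge 0$ for all choices of four distinct points $t_0,t_1,t_2,t_3\in I$. $f_+'$ and $f_-'$ denote the right and left derivatives of $f$. $f_+''(m)$ is the right derivative at $m$ of $f'$ and $f_-''(M)$ is the left derivative at $M$ of $f'$, where at the endpoints $m$ and $M$ the value of $f'$ is understood as $f_+'(m)$ and $f_-'(M)$, respectively. *)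

theory Defs
  imports "HOL-Analysis.Analysis"
begin

text \<open>The value for an empty list of nodes is a dummy; the recursion for two or more nodes is
  the usual one, and is meaningful for pairwise distinct nodes.\<close>

fun divided_difference :: "(real \<Rightarrow> real) \<Rightarrow> real list \<Rightarrow> real" where
  "divided_difference f [] = 0"
| "divided_difference f [t] = f t"
| "divided_difference f (t # u # us) =
     (divided_difference f (u # us) - divided_difference f (butlast (t # u # us)))
       / (last (u # us) - t)"

definition three_convex_on :: "real set \<Rightarrow> (real \<Rightarrow> real) \<Rightarrow> bool" where
  "three_convex_on I f \<longleftrightarrow>
     (\<forall>t0\<in>I. \<forall>t1\<in>I. \<forall>t2\<in>I. \<forall>t3\<in>I.
        distinct [t0, t1, t2, t3] \<longrightarrow> 0 \<le> divided_difference f [t0, t1, t2, t3])"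

definition right_deriv :: "(real \<Rightarrow> real) \<Rightarrow> real \<Rightarrow> real" where
  "right_deriv f x = vector_derivative f (at_right x)"

definition left_deriv :: "(real \<Rightarrow> real) \<Rightarrow> real \<Rightarrow> real" where
  "left_deriv f x = vector_derivative f (at_left x)"

text \<open>The derivative of \<open>f\<close> on \<open>[m, M]\<close>, one-sided at the two endpoints. The one-sided second
  derivatives of \<open>f\<close> at \<open>m\<close> and \<open>M\<close> are the one-sided derivatives of this function.\<close>

definition deriv_Icc :: "(real \<Rightarrow> real) \<Rightarrow> real \<Rightarrow> real \<Rightarrow> real \<Rightarrow> real" where
  "deriv_Icc f m M x =
     (if x = m then right_deriv f m else if x = M then left_deriv f M else deriv f x)"

definition prob_distribution :: "nat \<Rightarrow> (nat \<Rightarrow> real) \<Rightarrow> bool" where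
  "prob_distribution n p \<longleftrightarrow> (\<forall>i\<in>{1..n}. p i \<in> {0..1}) \<and> (\<Sum>i=1..n. p i) = 1"

definition f_divergence :: "nat \<Rightarrow> (real \<Rightarrow> real) \<Rightarrow> (nat \<Rightarrow> real) \<Rightarrow> (nat \<Rightarrow> real) \<Rightarrow> real" where
  "f_divergence n f p q = (\<Sum>i=1..n. q i * f (p i / q i))"

end

theory Submission
  imports Defs
begin

text \<open>
  The chord of \<open>f\<close> over \<open>[m, M]\<close> is affine, so its \<open>q\<close>-weighted average over the ratios
  \<open>p i / q i\<close> is its value at their mean \<open>1\<close>, which is the sum
  \<open>(M - 1) / (M - m) * f m + (1 - m) / (M - m) * f M\<close>. Expanding this value from \<open>m\<close> or from
  \<open>M\<close> cancels the slope of the chord on the outer sides. The two inequalities then say that the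
  divergence lies above the weighted average of the second order Taylor polynomial of \<open>f\<close> at \<open>m\<close>
  (taken from the right) and below that of the Taylor polynomial at \<open>M\<close> (taken from the left).
  Both hold term by term, so the theorem is about the one-variable bounds
  \<open>three_convex_taylor_right\<close> and \<open>three_convex_taylor_left\<close>.

  These bounds follow by integrating a tangent line inequality for \<open>f'\<close>, since the derivative of a
  3-convex function is convex. A 3-convex \<open>f\<close> is differentiable on an open set because, for fixed
  \<open>a\<close>, the difference quotients \<open>[a, t]f\<close> form a function of \<open>t \<noteq> a\<close> whose own difference
  quotients are monotone. Such a function is Lipschitz near \<open>a\<close> and so has a limit at \<open>a\<close>.
  Letting two nodes of a third divided difference merge gives \<open>[a, a, b, c]f \<ge> 0\<close>, and the three
  instances with a doubled node \<open>x\<close>, \<open>y\<close> or \<open>z\<close> combine linearly to give the convexity inequality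
  for \<open>f'\<close> at \<open>x < y < z\<close>. Convexity also provides the one-sided second derivatives.
\<close>

section \<open>Divided differences as iterated slopes\<close>

definition slope :: "(real \<Rightarrow> real) \<Rightarrow> real \<Rightarrow> real \<Rightarrow> real" where
  "slope f a t = (f t - f a) / (t - a)"

lemma slope_commute: "slope f a t = slope f t a"
  unfolding slope_def by (metis minus_diff_eq minus_divide_divide)

lemma slope_of_slope_swap:
  assumes "distinct [x, y, a]"
  shows "slope (slope f a) x y = (slope f y a - slope f x y) / (a - x)"
  using assms by (simp add: slope_def divide_simps) (simp add: algebra_simps)

text \<open>With the base node \<open>a\<close> in the third place, the recursion for divided differences leaves
  \<open>[y, a, z]f\<close>, already a slope of \<open>t \<mapsto> [a, t]f\<close>, and \<open>[x, y, a]f\<close>, which becomes one by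
  symmetry. No order of the nodes is imposed, so \<open>a\<close> and \<open>y\<close> may lie anywhere.\<close>

lemma divided_difference_eq_slope_difference:
  assumes "distinct [x, y, z, a]"
  shows "divided_difference f [x, y, a, z]
       = (slope (slope f a) y z - slope (slope f a) x y) / (z - x)"
proof -
  have "slope (slope f a) x y = (slope f y a - slope f x y) / (a - x)"
    by (rule slope_of_slope_swap) (use assms in auto)
  then show ?thesis
    using slope_commute[of f y a] by (simp add: slope_def)
qed

text \<open>For \<open>x < y < z\<close> this is convexity of \<open>t \<mapsto> [a, t]f\<close> away from \<open>a\<close>. The case of a
  middle argument \<open>y\<close> outside \<open>[x, z]\<close> is what allows \<open>y\<close> to tend to \<open>a\<close> later on.\<close>

lemma three_convex_slope_mono:
  assumes "three_convex_on J f" "a \<in> J" "x \<in> J" "y \<in> J" "z \<in> J"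
    and "distinct [x, y, z, a]" "x < z"
  shows "slope (slope f a) x y \<le> slope (slope f a) y z"
proof -
  have "0 \<le> divided_difference f [x, y, a, z]"
    using assms unfolding three_convex_on_def by (metis distinct_length_2_or_more)
  then have "0 \<le> (slope (slope f a) y z - slope (slope f a) x y) / (z - x)"
    using divided_difference_eq_slope_difference[of x y z a f] assms(6) by simp
  then show ?thesis
    using \<open>x < z\<close> by (simp add: zero_le_divide_iff)
qed

section \<open>The derivative of a 3-convex function\<close>

text \<open>The derivative at \<open>a\<close> is the limit of \<open>h t = [a, t]f\<close>. Two pairs of outer points confine
  every slope of \<open>h\<close> between inner points, on either side of \<open>a\<close> or across it. Hence \<open>h\<close> is
  Lipschitz on a punctured neighbourhood and extends continuously to \<open>a\<close>.\<close>

lemma three_convex_has_derivative: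
  assumes tc: "three_convex_on J f" and "open J" "a \<in> J"
  shows "(f has_real_derivative deriv f a) (at a)"
proof -
  obtain r where r: "r > 0" "cball a r \<subseteq> J"
    using open_contains_cball assms(2,3) by blast
  define u0 u1 v0 v1 where uv: "u0 = a - r" "u1 = a - r / 2" "v0 = a + r" "v1 = a + r / 2"
  define X where "X = ball a (r / 2) - {a}"
  have J: "t \<in> J" if "\<bar>t - a\<bar> \<le> r" for t
    using r(2) that by (auto simp: dist_real_def subset_iff)
  define h where "h = slope f a"
  define C where "C = max \<bar>slope h u0 u1\<bar> \<bar>slope h v1 v0\<bar>"
  have mono: "slope h x y \<le> slope h y z"
    if "\<bar>x - a\<bar> \<le> r" "\<bar>y - a\<bar> \<le> r" "\<bar>z - a\<bar> \<le> r" "x < y" "y < z" "a \<notin> {x, y, z}" for x y z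
    unfolding h_def
    by (rule three_convex_slope_mono[OF tc]) (use that J \<open>a \<in> J\<close> in auto)
  have bound: "\<bar>slope h s t\<bar> \<le> C" if "s \<in> X" "t \<in> X" "s < t" for s t
  proof -
    have st: "u1 < s" "t < v1" "\<bar>s - a\<bar> \<le> r" "\<bar>t - a\<bar> \<le> r" "s \<noteq> a" "t \<noteq> a"
    proof -
      have "\<bar>s - a\<bar> < r / 2" "\<bar>t - a\<bar> < r / 2" "s \<noteq> a" "t \<noteq> a"
        using that(1,2) by (auto simp: X_def dist_real_def abs_minus_commute)
      then show "u1 < s" "t < v1" "\<bar>s - a\<bar> \<le> r" "\<bar>t - a\<bar> \<le> r" "s \<noteq> a" "t \<noteq> a"
        unfolding uv by linarith+
    qed
    have "slope h u0 u1 \<le> slope h u1 s" "slope h u1 s \<le> slope h s t"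
         "slope h s t \<le> slope h t v1" "slope h t v1 \<le> slope h v1 v0"
      by (rule mono; use st that r(1) in \<open>auto simp: uv\<close>)+
    then show ?thesis
      unfolding C_def by linarith
  qed
  have lip_less: "\<bar>h t - h s\<bar> \<le> C * \<bar>t - s\<bar>" if "s \<in> X" "t \<in> X" "s < t" for s t
    using bound[OF that] that(3) by (simp add: slope_def abs_divide pos_divide_le_eq)
  have "C \<ge> 0"
    by (simp add: C_def)
  then have "C-lipschitz_on X h"
    unfolding lipschitz_on_def dist_real_def
    by (metis abs_minus_commute diff_self abs_zero linorder_neqE_linordered_idom lip_less mult_zero_right order_refl)
  then have "uniformly_continuous_on X h"
    by (rule lipschitz_on_uniformly_continuous)
  moreover have "a \<in> closure X"
  proof -
    have "a islimpt ball a (r / 2)"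
      using r(1) by (intro interior_limit_point) auto
    then show ?thesis
      unfolding X_def by (simp add: closure_def islimpt_punctured[symmetric])
  qed
  ultimately obtain d where "(h \<longlongrightarrow> d) (at a within X)"
    using uniformly_continuous_on_extension_at_closure by metis
  moreover have "at a within X = at a"
    using at_within_open[of a "ball a (r / 2)"] r(1)
    by (simp add: X_def at_within_def Diff_Int_distrib)
  ultimately have "(f has_real_derivative d) (at a)"
    by (simp add: has_field_derivative_iff h_def slope_def[abs_def])
  then show ?thesis
    using DERIV_imp_deriv by metis
qed

text \<open>The inequality \<open>[a, a, b, c]f \<ge> 0\<close>, written as monotonicity of \<open>t \<mapsto> [a, a, t]f\<close>. It is
  the limit of \<open>[a, s, b, c]f \<ge> 0\<close> as \<open>s\<close> tends to \<open>a\<close>.\<close>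

lemma three_convex_confluent:
  assumes tc: "three_convex_on J f" and "open J" "a \<in> J" "b \<in> J" "c \<in> J"
    and "a \<noteq> b" "a \<noteq> c" "b < c"
  shows "(slope f a b - deriv f a) / (b - a) \<le> (slope f a c - deriv f a) / (c - a)"
proof (rule tendsto_le)
  have lim: "(slope f a \<longlongrightarrow> deriv f a) (at a)"
    using three_convex_has_derivative[OF assms(1-3)]
    by (simp add: has_field_derivative_iff slope_def[abs_def])
  show "((\<lambda>s. (slope f a b - slope f a s) / (b - s)) \<longlongrightarrow> (slope f a b - deriv f a) / (b - a)) (at a)"
    using assms(6) by (intro tendsto_intros lim) auto
  show "((\<lambda>s. (slope f a c - slope f a s) / (c - s)) \<longlongrightarrow> (slope f a c - deriv f a) / (c - a)) (at a)"
    using assms(7) by (intro tendsto_intros lim) auto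
  have "\<forall>\<^sub>F s in at a. s \<in> J - {b, c} - {a}"
    using assms(2,3,6,7) by (intro eventually_at_topological[THEN iffD2] exI[of _ "J - {b, c}"]) (auto intro: open_Diff)
  then show "\<forall>\<^sub>F s in at a. (slope f a b - slope f a s) / (b - s) \<le> (slope f a c - slope f a s) / (c - s)"
  proof eventually_elim
    case (elim s)
    have "slope (slope f a) b s \<le> slope (slope f a) s c"
      by (rule three_convex_slope_mono[OF tc]) (use elim assms in auto)
    then show ?case
      by (simp add: slope_commute[of "slope f a" b s]) (simp add: slope_def[of "slope f a"])
  qed
qed simp

text \<open>The algebra behind convexity of the derivative. For \<open>x < y < z\<close> the numbers \<open>u\<close> and \<open>v\<close> are
  the two gaps, \<open>R\<close>, \<open>S\<close> and \<open>T\<close> the slopes of \<open>f\<close> over \<open>[x, y]\<close>, \<open>[y, z]\<close> and \<open>[x, z]\<close>,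
  and \<open>X\<close>, \<open>Y\<close>, \<open>Z\<close> the derivatives at the nodes. With \<open>T\<close> eliminated, the three confluent
  inequalities bound \<open>X\<close> and \<open>Z\<close> from below and \<open>Y\<close> from above by combinations of \<open>R\<close> and \<open>S\<close>,
  and in the convexity inequality these bounds for the two sides coincide.\<close>

lemma confluent_inequalities_imp_convex:
  fixes u v :: real
  assumes "u > 0" "v > 0" and T: "(u + v) * T = u * R + v * S"
    and "(R - X) / u \<le> (T - X) / (u + v)"
    and "(Y - R) / u \<le> (S - Y) / v"
    and "(Z - T) / (u + v) \<le> (Z - S) / v"
  shows "(u + v) * Y \<le> v * X + u * Z"
proof -
  define w where "w = u + v"
  have pos: "w > 0"
    using assms by (simp add: w_def)
  have wT: "w * T = u * R + v * S"
    using T by (simp add: w_def)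
  have "w * (w * (R - X)) \<le> w * (u * (T - X))"
    using assms(4) pos assms(1) by (intro mult_left_mono) (simp_all add: field_simps flip: w_def)
  also have "\<dots> = u * (w * T - w * X)"
    by (simp add: algebra_simps)
  finally have "v * ((w + u) * R - u * S) \<le> v * (w * X)"
    unfolding wT by (simp add: w_def algebra_simps)
  moreover have "v * (u * R + v * S - w * Z) \<ge> w * (w * (S - Z))"
  proof -
    have "w * (v * (Z - T)) \<le> w * (w * (Z - S))"
      using assms(6) pos assms(2) by (intro mult_left_mono) (simp_all add: field_simps flip: w_def)
    then show ?thesis
      unfolding wT[symmetric] by (simp add: algebra_simps)
  qed
  then have "u * ((w + v) * S - v * R) \<le> u * (w * Z)"
    by (simp add: w_def algebra_simps)
  moreover have "w * (w * Y) \<le> w * (u * S + v * R)"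
    using assms(5) pos assms(1,2) by (intro mult_left_mono) (simp_all add: field_simps w_def)
  ultimately have "w * (w * Y) \<le> w * (v * X + u * Z)"
    by (simp add: w_def algebra_simps)
  then show ?thesis
    using pos by (simp add: w_def)
qed

lemma three_convex_deriv_convex:
  assumes tc: "three_convex_on J f" and "open J" "convex J"
  shows "convex_on J (deriv f)"
proof (rule convex_on_linorderI)
  fix t x z :: real
  assume t: "0 < t" "t < 1" and xz: "x \<in> J" "z \<in> J" "x < z"
  define y where "y = (1 - t) * x + t * z"
  have y1: "y - x = t * (z - x)" and y2: "z - y = (1 - t) * (z - x)"
    by (simp_all add: y_def algebra_simps)
  have "0 < y - x" "0 < z - y"
    unfolding y1 y2 using t xz by simp_all
  then have xyz: "x < y" "y < z"
    by simp_all
  have "y \<in> J"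
    using convexD[OF \<open>convex J\<close> xz(1,2), of "1 - t" t] t by (simp add: y_def)
  note conf = three_convex_confluent[OF tc \<open>open J\<close>]
  have flip: "(p - q) / (r - s) = (q - p) / (s - r)" for p q r s :: real
    by (metis minus_diff_eq minus_divide_divide)
  have "((y - x) + (z - y)) * deriv f y \<le> (z - y) * deriv f x + (y - x) * deriv f z"
  proof (rule confluent_inequalities_imp_convex)
    show "((y - x) + (z - y)) * slope f x z = (y - x) * slope f x y + (z - y) * slope f y z"
      using xyz by (simp add: slope_def)
    show "(slope f x y - deriv f x) / (y - x) \<le> (slope f x z - deriv f x) / ((y - x) + (z - y))"
      using conf[of x y z] xyz xz \<open>y \<in> J\<close> by simp
    show "(deriv f y - slope f x y) / (y - x) \<le> (slope f y z - deriv f y) / (z - y)"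
      using conf[of y x z] xyz xz \<open>y \<in> J\<close> by (simp add: slope_commute[of f y x] flip[of _ _ x y])
    show "(deriv f z - slope f x z) / ((y - x) + (z - y)) \<le> (deriv f z - slope f y z) / (z - y)"
      using conf[of z x y] xyz xz \<open>y \<in> J\<close>
      by (simp add: slope_commute[of f z] flip[of _ _ x z] flip[of _ _ y z])
  qed (use xyz in auto)
  then have "(z - x) * deriv f y \<le> (z - x) * ((1 - t) * deriv f x + t * deriv f z)"
    unfolding y1 y2 by (simp add: algebra_simps)
  then show "deriv f ((1 - t) *\<^sub>R x + t *\<^sub>R z) \<le> (1 - t) * deriv f x + t * deriv f z"
    using xz(3) by (simp add: y_def)
qed (use assms in auto)

section \<open>One-sided tangents of convex functions\<close>

text \<open>The slope of a convex function from \<open>a\<close> increases in the other endpoint and, for endpoints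
  to the right of \<open>a\<close>, is bounded below by any slope to the left. So the right derivative exists
  as the infimum of the slopes to the right, and each of these slopes is at least that infimum.\<close>

lemma convex_on_right_tangent:
  fixes g :: "real \<Rightarrow> real"
  assumes g: "convex_on J g" and "open J" "a \<in> J"
  obtains A where "(g has_real_derivative A) (at_right a)"
    and "\<And>t. t \<in> J \<Longrightarrow> a \<le> t \<Longrightarrow> g a + A * (t - a) \<le> g t"
proof -
  obtain r where r: "r > 0" "cball a r \<subseteq> J"
    using open_contains_cball assms(2,3) by blast
  then have b: "a - r \<in> J"
    by (auto simp: dist_real_def subset_iff)
  define I where "I = {a<..} \<inter> J"
  define A where "A = Inf (slope g a ` I)"
  have mono: "slope g a s \<le> slope g a t" if "s \<in> J" "t \<in> J" "a < s" "s \<le> t" for s t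
  proof (cases "s = t")
    case False
    then show ?thesis
      using convex_on_slope_le(1)[OF g \<open>a \<in> J\<close> \<open>t \<in> J\<close> \<open>a < s\<close>] that
      by (simp add: slope_commute[of g a]) (simp add: slope_def)
  qed simp
  have low: "slope g a (a - r) \<le> slope g a t" if "t \<in> J" "a < t" for t
    unfolding slope_commute[of g a t]
    using convex_on_slope_le[OF g b \<open>t \<in> J\<close>, of a] that r(1) by (simp add: slope_def)
  have "(slope g a \<longlongrightarrow> A) (at a within I)"
    unfolding A_def I_def by (rule Lim_right_bound) (use mono low in auto)
  moreover have "at a within I = at_right a"
    unfolding I_def by (rule at_within_nhd[of a J]) (use assms(2,3) in auto)
  ultimately have "(g has_real_derivative A) (at_right a)"
    by (simp add: has_field_derivative_iff slope_def[abs_def])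
  moreover have "g a + A * (t - a) \<le> g t" if "t \<in> J" "a \<le> t" for t
  proof (cases "t = a")
    case False
    then have "A \<le> slope g a t"
      unfolding A_def using that low by (intro cInf_lower bdd_belowI2[of _ "slope g a (a - r)"]) (auto simp: I_def)
    then show ?thesis
      using False that by (simp add: slope_def pos_le_divide_eq)
  qed simp
  ultimately show thesis
    by (rule that)
qed

lemma convex_on_left_tangent:
  fixes g :: "real \<Rightarrow> real"
  assumes g: "convex_on J g" and "open J" "a \<in> J"
  obtains A where "(g has_real_derivative A) (at_left a)"
    and "\<And>t. t \<in> J \<Longrightarrow> t \<le> a \<Longrightarrow> g a - A * (a - t) \<le> g t"
proof -
  (* Reflection exchanges left and right tangents; the derivative changes sign. *)
  have "convex_on (uminus ` J) (\<lambda>x. g (- x))"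
    unfolding convex_on_def
  proof (intro conjI ballI allI impI)
    show "convex (uminus ` J)"
      by (intro convex_negations convex_on_imp_convex[OF g])
  next
    fix x y u v :: real
    assume "x \<in> uminus ` J" "y \<in> uminus ` J" and uv: "0 \<le> u" "0 \<le> v" "u + v = 1"
    then have "- x \<in> J" "- y \<in> J"
      by auto
    then have "g (u *\<^sub>R (- x) + v *\<^sub>R (- y)) \<le> u * g (- x) + v * g (- y)"
      using g uv unfolding convex_on_def by blast
    then show "g (- (u *\<^sub>R x + v *\<^sub>R y)) \<le> u * g (- x) + v * g (- y)"
      by simp
  qed
  moreover have "open (uminus ` J)" "- a \<in> uminus ` J"
    using assms by (auto intro: open_negations)
  ultimately obtain B where B: "((\<lambda>x. g (- x)) has_real_derivative B) (at_right (- a))"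
    "\<And>t. t \<in> uminus ` J \<Longrightarrow> - a \<le> t \<Longrightarrow> g (- (- a)) + B * (t - (- a)) \<le> g (- t)"
    by (rule convex_on_right_tangent) (rule that)
  have "(g has_real_derivative - B) (at_left a)"
  proof -
    have "((\<lambda>x. - ((g (- x) - g a) / (x + a))) \<longlongrightarrow> - B) (at_right (- a))"
      using B(1) by (intro tendsto_minus) (simp add: has_field_derivative_iff)
    moreover have "- ((g (- x) - g a) / (x + a)) = (g (- x) - g a) / (- x - a)" for x
      by (metis minus_add_distrib minus_divide_right uminus_add_conv_diff add.commute)
    ultimately show ?thesis
      unfolding has_field_derivative_iff filterlim_at_left_to_right[of _ _ a] by simp
  qed
  moreover have "g a - (- B) * (a - t) \<le> g t" if "t \<in> J" "t \<le> a" for t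
    using B(2)[of "- t"] that by simp
  ultimately show thesis
    by (rule that)
qed

section \<open>Second order Taylor bounds\<close>

text \<open>The derivative of \<open>f\<close> minus its Taylor polynomial is \<open>f'\<close> minus the right tangent of
  \<open>f'\<close> at \<open>a\<close>, which is nonnegative to the right of \<open>a\<close> because \<open>f'\<close> is convex.\<close>

lemma three_convex_taylor_right:
  assumes tc: "three_convex_on J f" and "open J" "convex J" "a \<in> J"
  obtains A where "(deriv f has_real_derivative A) (at_right a)"
    and "\<And>t. t \<in> J \<Longrightarrow> a \<le> t \<Longrightarrow> f a + deriv f a * (t - a) + A / 2 * (t - a)\<^sup>2 \<le> f t"
proof -
  obtain A where A: "(deriv f has_real_derivative A) (at_right a)"
    and tangent: "\<And>t. t \<in> J \<Longrightarrow> a \<le> t \<Longrightarrow> deriv f a + A * (t - a) \<le> deriv f t"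
    by (rule convex_on_right_tangent[OF three_convex_deriv_convex[OF assms(1-3)] assms(2,4)]) (rule that)
  have "f a + deriv f a * (t - a) + A / 2 * (t - a)\<^sup>2 \<le> f t" if "t \<in> J" "a \<le> t" for t
  proof -
    define \<phi> where "\<phi> s = f s - deriv f a * (s - a) - A / 2 * (s - a)\<^sup>2" for s
    have "\<phi> a \<le> \<phi> t"
    proof (rule DERIV_nonneg_imp_nondecreasing[OF \<open>a \<le> t\<close>])
      fix s assume s: "a \<le> s" "s \<le> t"
      then have "s \<in> J"
        using mem_is_interval_1_I[of J a t s] \<open>convex J\<close> \<open>a \<in> J\<close> \<open>t \<in> J\<close> by (simp add: is_interval_convex_1)
      then have "(\<phi> has_real_derivative deriv f s - deriv f a - A * (s - a)) (at s)"
        unfolding \<phi>_def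
        by (auto intro!: derivative_eq_intros three_convex_has_derivative[OF tc \<open>open J\<close>]
            simp: field_simps)
      then show "\<exists>y. (\<phi> has_real_derivative y) (at s) \<and> 0 \<le> y"
        using tangent[OF \<open>s \<in> J\<close> s(1)] by force
    qed
    then show ?thesis
      by (simp add: \<phi>_def)
  qed
  with A show thesis
    by (rule that)
qed

text \<open>To the left of \<open>a\<close> the difference between \<open>f\<close> and its Taylor polynomial is again
  increasing, but now it vanishes at the right end, so the inequality is reversed.\<close>

lemma three_convex_taylor_left:
  assumes tc: "three_convex_on J f" and "open J" "convex J" "a \<in> J"
  obtains A where "(deriv f has_real_derivative A) (at_left a)"
    and "\<And>t. t \<in> J \<Longrightarrow> t \<le> a \<Longrightarrow> f t \<le> f a - deriv f a * (a - t) + A / 2 * (a - t)\<^sup>2"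
proof -
  obtain A where A: "(deriv f has_real_derivative A) (at_left a)"
    and tangent: "\<And>t. t \<in> J \<Longrightarrow> t \<le> a \<Longrightarrow> deriv f a - A * (a - t) \<le> deriv f t"
    by (rule convex_on_left_tangent[OF three_convex_deriv_convex[OF assms(1-3)] assms(2,4)]) (rule that)
  have "f t \<le> f a - deriv f a * (a - t) + A / 2 * (a - t)\<^sup>2" if "t \<in> J" "t \<le> a" for t
  proof -
    define \<phi> where "\<phi> s = f s + deriv f a * (a - s) - A / 2 * (a - s)\<^sup>2" for s
    have "\<phi> t \<le> \<phi> a"
    proof (rule DERIV_nonneg_imp_nondecreasing[OF \<open>t \<le> a\<close>])
      fix s assume s: "t \<le> s" "s \<le> a"
      then have "s \<in> J"
        using mem_is_interval_1_I[of J t a s] \<open>convex J\<close> \<open>a \<in> J\<close> \<open>t \<in> J\<close> by (simp add: is_interval_convex_1)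
      then have "(\<phi> has_real_derivative deriv f s - deriv f a + A * (a - s)) (at s)"
        unfolding \<phi>_def
        by (auto intro!: derivative_eq_intros three_convex_has_derivative[OF tc \<open>open J\<close>]
            simp: field_simps)
      then show "\<exists>y. (\<phi> has_real_derivative y) (at s) \<and> 0 \<le> y"
        using tangent[OF \<open>s \<in> J\<close> s(2)] by force
    qed
    then show ?thesis
      by (simp add: \<phi>_def)
  qed
  with A show thesis
    by (rule that)
qed

section \<open>Averaging over the two distributions\<close>

lemma right_deriv_eqI: "(f has_real_derivative d) (at_right x) \<Longrightarrow> right_deriv f x = d"
  unfolding right_deriv_def
  by (intro vector_derivative_within) (simp_all add: has_real_derivative_iff_has_vector_derivative)

lemma left_deriv_eqI: "(f has_real_derivative d) (at_left x) \<Longrightarrow> left_deriv f x = d"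
  unfolding left_deriv_def
  by (intro vector_derivative_within) (simp_all add: has_real_derivative_iff_has_vector_derivative)

text \<open>The affine part averages to its value at \<open>1\<close>, because the weights \<open>q i\<close> sum to \<open>1\<close> and
  the ratios \<open>p i / q i\<close> have weighted mean \<open>1\<close>.\<close>

lemma sum_weighted_ratio:
  assumes "\<forall>i\<in>{1..n}. 0 < q i" "prob_distribution n p" "prob_distribution n q"
  shows "(\<Sum>i=1..n. q i * (\<alpha> + \<beta> * (p i / q i) + \<gamma> * (p i / q i - c)\<^sup>2))
       = \<alpha> + \<beta> + \<gamma> * (\<Sum>i=1..n. (p i - c * q i)\<^sup>2 / q i)"
proof -
  have "q i * (\<alpha> + \<beta> * (p i / q i) + \<gamma> * (p i / q i - c)\<^sup>2)
      = \<alpha> * q i + \<beta> * p i + \<gamma> * ((p i - c * q i)\<^sup>2 / q i)" if "i \<in> {1..n}" for i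
  proof -
    have q: "q i \<noteq> 0"
      using assms(1) that by force
    then have "p i - c * q i = q i * (p i / q i - c)"
      by (simp add: right_diff_distrib)
    then have "(p i - c * q i)\<^sup>2 / q i = q i * (p i / q i - c)\<^sup>2"
      using q by (simp add: power_mult_distrib power2_eq_square)
    then show ?thesis
      using q by (simp add: algebra_simps)
  qed
  then have "(\<Sum>i=1..n. q i * (\<alpha> + \<beta> * (p i / q i) + \<gamma> * (p i / q i - c)\<^sup>2))
      = (\<Sum>i=1..n. \<alpha> * q i + \<beta> * p i + \<gamma> * ((p i - c * q i)\<^sup>2 / q i))"
    by (intro sum.cong) auto
  also have "\<dots> = \<alpha> * (\<Sum>i=1..n. q i) + \<beta> * (\<Sum>i=1..n. p i) + \<gamma> * (\<Sum>i=1..n. (p i - c * q i)\<^sup>2 / q i)"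
    by (simp add: sum.distrib sum_distrib_left)
  finally show ?thesis
    using assms(2,3) by (simp add: prob_distribution_def)
qed

theorem theorem3p2:
  fixes m M :: real and I :: "real set" and f :: "real \<Rightarrow> real"
    and n :: nat and p q :: "nat \<Rightarrow> real"
  assumes "m < M" and "{m..M} \<subseteq> {0..}" and "m \<le> 1" and "1 \<le> M"
    and "is_interval I" and "{m..M} \<subseteq> interior I"
    and "three_convex_on I f"
    and "\<forall>x\<in>{m<..<M}. f differentiable (at x)"
    and "prob_distribution n p" and "prob_distribution n q"
    and "\<forall>i\<in>{1..n}. 0 < q i" and "\<forall>i\<in>{1..n}. p i / q i \<in> {m..M}"
  shows "(M - 1) * (left_deriv f M - (f M - f m) / (M - m))
           - left_deriv (deriv_Icc f m M) M / 2 * (\<Sum>i=1..n. (M * q i - p i)\<^sup>2 / q i)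
         \<le> (M - 1) / (M - m) * f m + (1 - m) / (M - m) * f M - f_divergence n f p q
       \<and> (M - 1) / (M - m) * f m + (1 - m) / (M - m) * f M - f_divergence n f p q
         \<le> (1 - m) * ((f M - f m) / (M - m) - right_deriv f m)
           - right_deriv (deriv_Icc f m M) m / 2 * (\<Sum>i=1..n. (p i - m * q i)\<^sup>2 / q i)"
proof -
  define J where "J = interior I"
  have J: "open J" "convex J" "three_convex_on J f" and mJ: "m \<in> J" and MJ: "M \<in> J"
    and sub: "{m..M} \<subseteq> J"
    using assms interior_subset[of I]
    by (auto simp: J_def three_convex_on_def is_interval_convex_1 convex_interior subset_iff)
  obtain A where A: "(deriv f has_real_derivative A) (at_right m)"
    and taylor_m: "\<And>t. t \<in> J \<Longrightarrow> m \<le> t \<Longrightarrow> f m + deriv f m * (t - m) + A / 2 * (t - m)\<^sup>2 \<le> f t"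
    by (rule three_convex_taylor_right[OF J(3,1,2) mJ]) (rule that)
  obtain B where B: "(deriv f has_real_derivative B) (at_left M)"
    and taylor_M: "\<And>t. t \<in> J \<Longrightarrow> t \<le> M \<Longrightarrow> f t \<le> f M - deriv f M * (M - t) + B / 2 * (M - t)\<^sup>2"
    by (rule three_convex_taylor_left[OF J(3,1,2) MJ]) (rule that)
  have fm: "right_deriv f m = deriv f m" and fM: "left_deriv f M = deriv f M"
    using three_convex_has_derivative[OF J(3,1)] mJ MJ
    by (blast intro: right_deriv_eqI left_deriv_eqI has_field_derivative_at_within)+
  (* Since f is differentiable also at m and M, the one-sided modification changes nothing. *)
  then have Icc: "deriv_Icc f m M x = deriv f x" for x
    by (simp add: deriv_Icc_def)
  have fm2: "right_deriv (deriv_Icc f m M) m = A" and fM2: "left_deriv (deriv_Icc f m M) M = B"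
    using A B by (auto simp: Icc[abs_def] intro!: right_deriv_eqI left_deriv_eqI)
  define V where "V c = (\<Sum>i=1..n. (p i - c * q i)\<^sup>2 / q i)" for c
  have VM: "(\<Sum>i=1..n. (M * q i - p i)\<^sup>2 / q i) = V M"
    by (simp add: V_def power2_commute)
  note avg = sum_weighted_ratio[OF assms(11,9,10), folded V_def]
  have in_J: "p i / q i \<in> J" "m \<le> p i / q i" "p i / q i \<le> M" if "i \<in> {1..n}" for i
    using assms(12) sub that by auto
  have "f m + deriv f m * (1 - m) + A / 2 * V m \<le> f_divergence n f p q"
  proof -
    have "(f m - deriv f m * m) + deriv f m + A / 2 * V m
        = (\<Sum>i=1..n. q i * ((f m - deriv f m * m) + deriv f m * (p i / q i) + A / 2 * (p i / q i - m)\<^sup>2))"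
      by (rule avg[symmetric])
    also have "\<dots> \<le> f_divergence n f p q"
      unfolding f_divergence_def
    proof (intro sum_mono mult_left_mono)
      fix i assume i: "i \<in> {1..n}"
      show "(f m - deriv f m * m) + deriv f m * (p i / q i) + A / 2 * (p i / q i - m)\<^sup>2 \<le> f (p i / q i)"
        using taylor_m[OF in_J(1,2)[OF i]] unfolding right_diff_distrib by linarith
    qed (use assms(11) in \<open>auto intro: less_imp_le\<close>)
    finally show ?thesis
      by (simp add: algebra_simps)
  qed
  moreover have "f_divergence n f p q \<le> f M - deriv f M * (M - 1) + B / 2 * V M"
  proof -
    have "f_divergence n f p q
        \<le> (\<Sum>i=1..n. q i * ((f M - deriv f M * M) + deriv f M * (p i / q i) + B / 2 * (p i / q i - M)\<^sup>2))"
      unfolding f_divergence_def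
    proof (intro sum_mono mult_left_mono)
      fix i assume i: "i \<in> {1..n}"
      show "f (p i / q i) \<le> (f M - deriv f M * M) + deriv f M * (p i / q i) + B / 2 * (p i / q i - M)\<^sup>2"
        using taylor_M[OF in_J(1,3)[OF i]] power2_commute[of M "p i / q i"]
        unfolding right_diff_distrib by simp
    qed (use assms(11) in \<open>auto intro: less_imp_le\<close>)
    also have "\<dots> = (f M - deriv f M * M) + deriv f M + B / 2 * V M"
      by (rule avg)
    finally show ?thesis
      by (simp add: algebra_simps)
  qed
  (* The value of the chord at 1, measured once from each end of the interval. *)
  moreover have "(M - 1) / (M - m) * f m + (1 - m) / (M - m) * f M
      = f m + (1 - m) * ((f M - f m) / (M - m))"
    using assms(1) by (simp add: divide_simps) algebra
  moreover have "(M - 1) / (M - m) * f m + (1 - m) / (M - m) * f M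
      = f M - (M - 1) * ((f M - f m) / (M - m))"
    using assms(1) by (simp add: divide_simps) algebra
  ultimately show ?thesis
    unfolding fm fM fm2 fM2 VM V_def[symmetric] by (simp add: algebra_simps)
qed

end
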